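(* Uniformly over all $f\colon\mathbb{N}\to\mathbb{C}$ with $\|f\|_\infty\le1$, \[ \mathbb{E}_{n\le N}\,\mathbb{E}^{\mathrm{bin}}_{k\le n}f(k)=\mathbb{E}^{\mathrm{bin}}_{n\le N}\,\mathbb{E}_{k\le n}f(k)=\mathbb{E}_{n\le\lfloor N/2\rfloor}f(n)+o_{N\to\infty}(1). \]
   Context: $\mathbb{E}_{n\le N}f(n)=\frac1N\sum_{n=1}^Nf(n)$ (Cesàro average) and $\mathbb{E}^{\mathrm{bin}}_{n\le N}f(n)=\frac{1}{2^N}\sum_{n=1}^N\binom{N}{n}f(n)$ (binomial mean).
   Formalization: The first equality is proved only up to a uniform o(1) error, since exact equality fails: for N = 2, f(1) = 1 and f = 0 elsewhere, the two iterated means are 1/2 and 5/8. *)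

theory Defs
  imports "HOL-Analysis.Analysis"
begin

(* Arithmetic functions live on the positive integers; as functions on nat, their
   value at 0 is irrelevant: it occurs neither in the means nor in the bound. *)

definition cesaro_mean :: "nat \<Rightarrow> (nat \<Rightarrow> complex) \<Rightarrow> complex" where
  "cesaro_mean N f = (1 / of_nat N) * (\<Sum>n=1..N. f n)"

(* The sum starts at n = 1 although the weight is that of the binomial distribution
   on {0..N}, so the total mass is 1 - 1 / 2 ^ N. *)
definition binomial_mean :: "nat \<Rightarrow> (nat \<Rightarrow> complex) \<Rightarrow> complex" where
  "binomial_mean N f = (1 / 2 ^ N) * (\<Sum>n=1..N. of_nat (N choose n) * f n)"

definition sup_unit_ball :: "(nat \<Rightarrow> complex) set" where
  "sup_unit_ball = {f. \<forall>n\<ge>1. norm (f n) \<le> 1}"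

end

theory Submission
  imports Defs "HOL-Real_Asymp.Real_Asymp"
begin

text \<open>
  Write \<open>S n = f 1 + \<dots> + f n\<close> and let \<open>X N\<close> be binomially distributed with parameters \<open>N\<close> and
  \<open>1/2\<close>. By induction along Pascal's rule, the Cesaro mean of the binomial means equals
  \<open>2/N\<close> times the expectation of \<open>S (X (N + 1) - 1)\<close>, while the binomial mean of the Cesaro means is
  the expectation of \<open>S (X N) / X N\<close>. As \<open>S\<close> is 1-Lipschitz and \<open>X N\<close> deviates from \<open>N/2\<close> by at
  most \<open>sqrt N / 2\<close> in mean, both are within \<open>O(1 / sqrt N)\<close> of \<open>S (N div 2) / (N div 2)\<close>.
\<close>

text \<open>Pascal's rule and an index shift. Read as expectations, this conditions on one toss, and
  it drives both inductions below, for the variance and for the sum of binomial means.\<close>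

lemma sum_choose_Suc_mult:
  fixes g :: "nat \<Rightarrow> 'a::comm_semiring_1"
  shows "(\<Sum>j\<le>Suc n. of_nat (Suc n choose j) * g j)
       = (\<Sum>j\<le>n. of_nat (n choose j) * (g j + g (Suc j)))"
proof -
  have "(\<Sum>j\<le>Suc n. of_nat (Suc n choose j) * g j)
      = g 0 + (\<Sum>j\<le>n. of_nat (Suc n choose Suc j) * g (Suc j))"
    by (simp add: sum.atMost_Suc_shift del: sum.atMost_Suc binomial_Suc_Suc)
  also have "\<dots> = (g 0 + (\<Sum>j\<le>n. of_nat (n choose Suc j) * g (Suc j)))
                 + (\<Sum>j\<le>n. of_nat (n choose j) * g (Suc j))"
    by (simp add: algebra_simps sum.distrib)
  also have "g 0 + (\<Sum>j\<le>n. of_nat (n choose Suc j) * g (Suc j))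
           = (\<Sum>j\<le>Suc n. of_nat (n choose j) * g j)"
    by (simp add: sum.atMost_Suc_shift del: sum.atMost_Suc)
  also have "\<dots> = (\<Sum>j\<le>n. of_nat (n choose j) * g j)"
    by (simp add: binomial_eq_0)
  finally show ?thesis
    by (simp add: algebra_simps sum.distrib)
qed

lemma sum_choose_real: "(\<Sum>j\<le>n. real (n choose j)) = 2 ^ n"
  using choose_row_sum[of n] by (metis of_nat_numeral of_nat_power of_nat_sum)

text \<open>One more toss turns the deviation \<open>d = 2 * j - n\<close> into \<open>d - 1\<close>
  or \<open>d + 1\<close>, and the cross terms of the two squares cancel, leaving
  \<open>2 * d^2 + 2\<close>.\<close>

lemma sum_choose_variance:
  "(\<Sum>j\<le>n. real (n choose j) * (2 * real j - real n)\<^sup>2) = real n * 2 ^ n"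
proof (induction n)
  case (Suc n)
  have "(\<Sum>j\<le>Suc n. real (Suc n choose j) * (2 * real j - real (Suc n))\<^sup>2)
      = (\<Sum>j\<le>n. 2 * (real (n choose j) * (2 * real j - real n)\<^sup>2) + 2 * real (n choose j))"
    unfolding sum_choose_Suc_mult
    by (intro sum.cong) (auto simp: algebra_simps power2_eq_square)
  also have "\<dots> = 2 * (real n * 2 ^ n) + 2 * 2 ^ n"
    by (simp add: sum.distrib Suc.IH sum_choose_real flip: sum_distrib_left)
  finally show ?case
    by (simp add: algebra_simps)
qed simp

lemma sum_choose_abs_deviation_le:
  "(\<Sum>j\<le>n. real (n choose j) * \<bar>2 * real j - real n\<bar>) \<le> sqrt (real n) * 2 ^ n"
proof (cases "n = 0")
  case False
  \<comment> \<open>The AM-GM bound below holds for every positive \<open>s\<close>. With this value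
    the variance term and the constant term both contribute \<open>s / 2 * 2 ^ n\<close>.\<close>
  define s where "s = sqrt (real n)"
  have s: "s > 0" "s\<^sup>2 = real n"
    using False by (auto simp: s_def)
  have am_gm: "\<bar>x\<bar> \<le> x\<^sup>2 / (2 * s) + s / 2" for x
  proof -
    have "0 \<le> (\<bar>x\<bar> - s)\<^sup>2"
      by simp
    then have "2 * s * \<bar>x\<bar> \<le> x\<^sup>2 + s\<^sup>2"
      by (simp add: power2_diff algebra_simps)
    then show ?thesis
      using s(1) by (simp add: field_simps power2_eq_square)
  qed
  have "(\<Sum>j\<le>n. real (n choose j) * \<bar>2 * real j - real n\<bar>)
      \<le> (\<Sum>j\<le>n. real (n choose j) * ((2 * real j - real n)\<^sup>2 / (2 * s) + s / 2))"
    by (intro sum_mono mult_left_mono am_gm) auto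
  also have "\<dots> = (\<Sum>j\<le>n. real (n choose j) * (2 * real j - real n)\<^sup>2) / (2 * s)
                  + (\<Sum>j\<le>n. real (n choose j)) * (s / 2)"
    by (simp add: distrib_left sum.distrib sum_divide_distrib sum_distrib_right)
  also have "\<dots> = s * 2 ^ n"
    unfolding sum_choose_variance sum_choose_real unfolding s(2)[symmetric]
    using s(1) by (simp add: field_simps power2_eq_square)
  finally show ?thesis
    by (simp add: s_def)
qed simp

text \<open>Moving the centre from \<open>n / 2\<close> to \<open>c\<close> costs at most 1/2. This
  slack allows integer centres for either parity of \<open>n\<close>.\<close>

lemma sum_choose_abs_diff_le:
  assumes "\<bar>2 * c - real n\<bar> \<le> 1"
  shows "(\<Sum>j\<le>n. real (n choose j) * \<bar>real j - c\<bar>) \<le> (sqrt (real n) + 1) / 2 * 2 ^ n"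
proof -
  have "\<bar>real j - c\<bar> \<le> (\<bar>2 * real j - real n\<bar> + 1) / 2" for j
    using assms by (simp add: abs_if field_simps split: if_splits)
  then have "(\<Sum>j\<le>n. real (n choose j) * \<bar>real j - c\<bar>)
      \<le> (\<Sum>j\<le>n. real (n choose j) * ((\<bar>2 * real j - real n\<bar> + 1) / 2))"
    by (intro sum_mono mult_left_mono) auto
  also have "\<dots> = ((\<Sum>j\<le>n. real (n choose j) * \<bar>2 * real j - real n\<bar>)
                    + (\<Sum>j\<le>n. real (n choose j))) / 2"
    by (simp add: distrib_left sum.distrib add_divide_distrib sum_divide_distrib)
  also have "\<dots> \<le> (sqrt (real n) * 2 ^ n + 2 ^ n) / 2"
    using sum_choose_abs_deviation_le[of n] by (simp add: sum_choose_real)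
  finally show ?thesis
    by (simp add: algebra_simps)
qed

text \<open>The binomial weights have total mass 1, so \<open>a\<close> can be moved inside the
  mean. The Lipschitz-type bound is needed only around the centre \<open>c\<close>; it is applied to
  Cesaro means and to partial sums.\<close>

lemma norm_choose_mean_diff_le:
  fixes g :: "nat \<Rightarrow> complex"
  assumes c: "\<bar>2 * c - real n\<bar> \<le> 1" and "0 \<le> K"
    and g: "\<And>j. norm (g j - a) \<le> K * \<bar>real j - c\<bar>"
  shows "norm ((\<Sum>j\<le>n. of_nat (n choose j) * g j) / 2 ^ n - a) \<le> K * ((sqrt (real n) + 1) / 2)"
proof -
  have "(\<Sum>j\<le>n. of_nat (n choose j) * g j) / 2 ^ n - a
      = (\<Sum>j\<le>n. of_nat (n choose j) * (g j - a)) / 2 ^ n"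
    using arg_cong[OF sum_choose_real[of n], of complex_of_real]
    by (simp add: right_diff_distrib sum_subtractf field_simps flip: sum_distrib_left)
  also have "norm \<dots> = norm (\<Sum>j\<le>n. of_nat (n choose j) * (g j - a)) / 2 ^ n"
    by (simp add: norm_divide norm_power)
  also have "\<dots> \<le> (\<Sum>j\<le>n. real (n choose j) * (K * \<bar>real j - c\<bar>)) / 2 ^ n"
    by (intro divide_right_mono sum_norm_le) (auto simp: norm_mult intro!: mult_left_mono g)
  also have "\<dots> = K * (\<Sum>j\<le>n. real (n choose j) * \<bar>real j - c\<bar>) / 2 ^ n"
    by (simp add: sum_distrib_left mult_ac)
  also have "\<dots> \<le> K * ((sqrt (real n) + 1) / 2 * 2 ^ n) / 2 ^ n"
    by (intro divide_right_mono mult_left_mono sum_choose_abs_diff_le c \<open>0 \<le> K\<close>) auto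
  finally show ?thesis
    by simp
qed

lemma norm_sum_diff_le:
  assumes "f \<in> sup_unit_ball"
  shows "norm (sum f {1..m} - sum f {1..n}) \<le> \<bar>real m - real n\<bar>"
proof (induction m n rule: linorder_wlog)
  case (le m n)
  have "sum f {1..n} = sum f {1..m} + sum f {Suc m..n}"
    using sum.ub_add_nat[of 1 m f "n - m"] le by simp
  moreover have "norm (sum f {Suc m..n}) \<le> (\<Sum>k\<in>{Suc m..n}. 1)"
    using assms by (intro sum_norm_le) (auto simp: sup_unit_ball_def)
  ultimately show ?case
    using le by (simp add: norm_minus_commute of_nat_diff)
qed (simp add: norm_minus_commute abs_minus_commute)

lemma norm_sum_le:
  assumes "f \<in> sup_unit_ball"
  shows "norm (sum f {1..m}) \<le> real m"
  using norm_sum_diff_le[OF assms, of m 0] by simp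

text \<open>Changing the range of summation and changing the normalisation each cost at most
  \<open>\<bar>n - m\<bar> / m\<close>. The constant depends only on \<open>m\<close>, the fixed
  centre, while \<open>n\<close> runs over all binomial outcomes, including 0.\<close>

lemma cesaro_mean_diff_le:
  assumes f: "f \<in> sup_unit_ball" and m: "m > 0"
  shows "norm (cesaro_mean n f - cesaro_mean m f) \<le> 2 / real m * \<bar>real n - real m\<bar>"
proof (cases "n = 0")
  \<comment> \<open>Here \<open>cesaro_mean n f\<close> is 0 as an empty sum, and the right-hand
    side equals 2.\<close>
  case True
  then show ?thesis
    using norm_sum_le[OF f, of m] m
    by (simp add: cesaro_mean_def norm_divide field_simps)
next
  case False
  define S where "S k = sum f {1..k}" for k
  have "cesaro_mean n f - cesaro_mean m f
      = (S n - S m) / of_nat m + S n * of_real (real m - real n) / (of_nat n * of_nat m)"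
    using False m by (simp add: cesaro_mean_def S_def field_simps)
  also have "norm \<dots> \<le> norm (S n - S m) / real m
      + norm (S n) * \<bar>real m - real n\<bar> / (real n * real m)"
    by (intro norm_triangle_le add_mono) (simp_all add: norm_divide norm_mult del: of_real_diff)
  also have "\<dots> \<le> \<bar>real n - real m\<bar> / real m
      + real n * \<bar>real m - real n\<bar> / (real n * real m)"
    unfolding S_def
    by (intro add_mono divide_right_mono mult_right_mono norm_sum_diff_le norm_sum_le f) auto
  also have "\<dots> = 2 / real m * \<bar>real n - real m\<bar>"
    using False m by (simp add: field_simps abs_minus_commute)
  finally show ?thesis .
qed

text \<open>Restores the missing term at 0, so that the estimates for full binomial rows
  apply.\<close>

lemma binomial_mean_eq_sum_atMost:
  assumes "g 0 = 0"
  shows "binomial_mean n g = (\<Sum>j\<le>n. of_nat (n choose j) * g j) / 2 ^ n"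
  using assms
  by (simp add: binomial_mean_def atMost_atLeast0 sum.atLeast_Suc_atMost[of 0])

lemma binomial_mean_cesaro_mean_bound:
  assumes f: "f \<in> sup_unit_ball" and N: "N \<ge> 2"
  shows "norm (binomial_mean N (\<lambda>n. cesaro_mean n f) - cesaro_mean (N div 2) f)
       \<le> (sqrt (real N) + 1) / real (N div 2)"
proof -
  have "\<bar>2 * real (N div 2) - real N\<bar> \<le> 1"
    by linarith
  moreover have "N div 2 > 0"
    using N by simp
  ultimately have "norm ((\<Sum>j\<le>N. of_nat (N choose j) * cesaro_mean j f) / 2 ^ N - cesaro_mean (N div 2) f)
      \<le> 2 / real (N div 2) * ((sqrt (real N) + 1) / 2)"
    by (intro norm_choose_mean_diff_le[where c = "real (N div 2)"] cesaro_mean_diff_le f) auto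
  also have "\<dots> = (sqrt (real N) + 1) / real (N div 2)"
    by (simp add: divide_simps)
  finally show ?thesis
    by (simp add: binomial_mean_eq_sum_atMost cesaro_mean_def)
qed

text \<open>
  In probabilistic terms: \<open>n choose k\<close> over \<open>2 ^ Suc n\<close> is the probability that the success number
  \<open>Suc k\<close> of a sequence of fair coin tosses occurs at toss \<open>Suc n\<close>.
\<close>

lemma sum_binomial_mean_eq:
  "(\<Sum>n=1..N. binomial_mean n f)
     = (\<Sum>j\<le>Suc N. of_nat (Suc N choose j) * sum f {1..j - 1}) / 2 ^ N"
proof (induction N)
  case (Suc N)
  \<comment> \<open>At \<open>j = 0\<close> truncated subtraction makes both partial sums in
    \<open>step\<close> empty, so the increment there is 0 and not \<open>f 0\<close>.\<close>
  let ?f = "\<lambda>j. if j = 0 then 0 else f j"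
  have step: "sum f {1..j - 1} + sum f {1..Suc j - 1} = 2 * sum f {1..j - 1} + ?f j" for j
    by (cases j) auto
  have "(\<Sum>j\<le>Suc (Suc N). of_nat (Suc (Suc N) choose j) * sum f {1..j - 1})
      = 2 * (\<Sum>j\<le>Suc N. of_nat (Suc N choose j) * sum f {1..j - 1})
        + (\<Sum>j\<le>Suc N. of_nat (Suc N choose j) * ?f j)"
    unfolding sum_choose_Suc_mult[of "Suc N"] step
    by (simp only: distrib_left sum.distrib sum_distrib_left mult_ac)
  moreover have "(\<Sum>j\<le>Suc N. of_nat (Suc N choose j) * ?f j) / 2 ^ Suc N = binomial_mean (Suc N) f"
    by (subst binomial_mean_eq_sum_atMost[symmetric]) (simp_all add: binomial_mean_def)
  ultimately show ?case
    using Suc.IH by (simp add: add_divide_distrib del: sum.atMost_Suc binomial_Suc_Suc)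
qed simp

lemma cesaro_mean_binomial_mean_bound:
  assumes f: "f \<in> sup_unit_ball" and N: "N \<ge> 2"
  shows "norm (cesaro_mean N (\<lambda>n. binomial_mean n f) - cesaro_mean (N div 2) f)
       \<le> (sqrt (real (Suc N)) + 2) / real N"
proof -
  define m where "m = N div 2"
  have m: "m > 0" "2 * m \<le> N" "N \<le> 2 * m + 1"
    using N unfolding m_def by (simp, linarith, linarith)
  then have m': "\<bar>2 * real m - real N\<bar> \<le> 1" "\<bar>2 * real (Suc m) - real (Suc N)\<bar> \<le> 1"
    by simp_all
  \<comment> \<open>Dividing by \<open>2 ^ Suc N\<close> makes \<open>T\<close> a true expectation;
    the identity for the sum has \<open>2 ^ N\<close>, whence the factor 2 in
    \<open>2 * T / of_nat N\<close>. The shift \<open>j - 1\<close> moves the centre from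
    \<open>m\<close> to \<open>Suc m\<close>.\<close>
  define T where "T = (\<Sum>j\<le>Suc N. of_nat (Suc N choose j) * sum f {1..j - 1}) / 2 ^ Suc N"
  have "norm (sum f {1..j - 1} - sum f {1..m}) \<le> 1 * \<bar>real j - real (Suc m)\<bar>" for j
    using norm_sum_diff_le[OF f, of "j - 1" m] by (cases j) auto
  then have "norm (T - sum f {1..m}) \<le> 1 * ((sqrt (real (Suc N)) + 1) / 2)"
    unfolding T_def using m'(2) by (intro norm_choose_mean_diff_le[where c = "real (Suc m)"]) auto
  then have T: "norm (T - sum f {1..m}) \<le> (sqrt (real (Suc N)) + 1) / 2"
    by simp
  have "cesaro_mean N (\<lambda>n. binomial_mean n f) = 2 * T / of_nat N"
    unfolding cesaro_mean_def sum_binomial_mean_eq T_def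
    by (simp add: field_simps del: sum.atMost_Suc binomial_Suc_Suc)
  \<comment> \<open>The second summand is the error of replacing \<open>2 / N\<close> by
    \<open>1 / m\<close>. It vanishes for even \<open>N\<close> and has norm at most
    \<open>1 / N\<close> for odd \<open>N\<close>.\<close>
  then have "cesaro_mean N (\<lambda>n. binomial_mean n f) - cesaro_mean m f
      = 2 * (T - sum f {1..m}) / of_nat N
        + sum f {1..m} * of_real (2 * real m - real N) / (of_nat N * of_nat m)"
    using m N by (simp add: cesaro_mean_def field_simps)
  also have "norm \<dots> \<le> 2 * norm (T - sum f {1..m}) / real N
        + norm (sum f {1..m}) * \<bar>2 * real m - real N\<bar> / (real N * real m)"
    by (intro norm_triangle_le add_mono)
      (simp_all add: norm_divide norm_mult del: of_real_diff of_real_mult right_diff_distrib_numeral)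
  also have "\<dots> \<le> 2 * ((sqrt (real (Suc N)) + 1) / 2) / real N + real m * 1 / (real N * real m)"
    by (intro add_mono divide_right_mono mult_left_mono mult_mono T m'(1) norm_sum_le f) auto
  also have "\<dots> = (sqrt (real (Suc N)) + 2) / real N"
    using m N by (simp add: field_simps)
  finally show ?thesis
    by (simp add: m_def)
qed

theorem theorem4p2:
  shows "uniform_limit sup_unit_ball
           (\<lambda>N f. cesaro_mean N (\<lambda>n. binomial_mean n f)
                    - binomial_mean N (\<lambda>n. cesaro_mean n f))
           (\<lambda>f. 0) sequentially
       \<and> uniform_limit sup_unit_ball
           (\<lambda>N f. binomial_mean N (\<lambda>n. cesaro_mean n f) - cesaro_mean (N div 2) f)
           (\<lambda>f. 0) sequentially"
proof -
  let ?AB = "\<lambda>N f. cesaro_mean N (\<lambda>n. binomial_mean n f)"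
  let ?BA = "\<lambda>N f. binomial_mean N (\<lambda>n. cesaro_mean n f)"
  \<comment> \<open>A null sequence bounding the norm independently of \<open>f\<close> gives
    uniform convergence. The bound is required only from 2 on, where \<open>N div 2\<close> is
    positive.\<close>
  have uniform: "uniform_limit sup_unit_ball F (\<lambda>f. 0) sequentially"
    if bound: "\<And>N f. f \<in> sup_unit_ball \<Longrightarrow> N \<ge> 2 \<Longrightarrow> norm (F N f) \<le> b N"
      and b: "b \<longlonglongrightarrow> 0" for F :: "nat \<Rightarrow> (nat \<Rightarrow> complex) \<Rightarrow> complex" and b
  proof (rule uniform_limitI)
    fix e :: real
    assume "e > 0"
    with b have "\<forall>\<^sub>F N in sequentially. b N < e"
      by (rule order_tendstoD)
    then show "\<forall>\<^sub>F N in sequentially. \<forall>f\<in>sup_unit_ball. dist (F N f) 0 < e"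
      using eventually_ge_at_top[of 2]
      by eventually_elim (auto intro: le_less_trans[OF bound])
  qed
  have lim1: "(\<lambda>N. (sqrt (real (Suc N)) + 2) / real N) \<longlonglongrightarrow> 0"
    by real_asymp
  have lim2: "(\<lambda>N. (sqrt (real N) + 1) / real (N div 2)) \<longlonglongrightarrow> 0"
  \<comment> \<open>Since \<open>N div 2\<close> is at least \<open>(N - 1) / 2\<close>, there is a
    majorant free of integer division.\<close>
  proof (rule tendsto_sandwich[OF _ _ tendsto_const])
    show "(\<lambda>N. 2 * (sqrt (real N) + 1) / (real N - 1)) \<longlonglongrightarrow> 0"
      by real_asymp
    show "\<forall>\<^sub>F N in sequentially. (sqrt (real N) + 1) / real (N div 2) \<le> 2 * (sqrt (real N) + 1) / (real N - 1)"
      using eventually_ge_at_top[of 2]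
    proof eventually_elim
      case (elim N)
      have "real N \<le> real (2 * (N div 2) + 1)"
        unfolding of_nat_le_iff by linarith
      then have "(real N - 1) / 2 \<le> real (N div 2)"
        by simp
      then have "(sqrt (real N) + 1) / real (N div 2) \<le> (sqrt (real N) + 1) / ((real N - 1) / 2)"
        using elim by (intro divide_left_mono mult_pos_pos) auto
      then show ?case
        by (simp add: mult.commute)
    qed
  qed (auto intro!: always_eventually)
  \<comment> \<open>Both iterated means are compared with
    \<open>cesaro_mean (N div 2) f\<close>.\<close>
  have "norm (?AB N f - ?BA N f)
      \<le> (sqrt (real (Suc N)) + 2) / real N + (sqrt (real N) + 1) / real (N div 2)"
    if "f \<in> sup_unit_ball" "N \<ge> 2" for N f
    using cesaro_mean_binomial_mean_bound[OF that] binomial_mean_cesaro_mean_bound[OF that]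
      norm_triangle_ineq4[of "?AB N f - cesaro_mean (N div 2) f" "?BA N f - cesaro_mean (N div 2) f"]
    by simp
  then have "uniform_limit sup_unit_ball (\<lambda>N f. ?AB N f - ?BA N f) (\<lambda>f. 0) sequentially"
    by (rule uniform) (use tendsto_add[OF lim1 lim2] in simp_all)
  moreover have "uniform_limit sup_unit_ball (\<lambda>N f. ?BA N f - cesaro_mean (N div 2) f) (\<lambda>f. 0) sequentially"
    using binomial_mean_cesaro_mean_bound lim2 by (rule uniform)
  ultimately show ?thesis
    by blast
qed

end
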